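(* Consider the adjacency-list model augmented with $\texttt{JUMP}$, $\texttt{IN-SORTED}$ and $\texttt{ADJ}$. For any $n$ and $m$ with $n\le m\le n^2$ and any $\delta\in(0,1]$, there exists a directed graph $G=(V,E)$ with $\Theta(n)$ nodes, $\Theta(m)$ edges, and a node $t\in V$, such that for any algorithm solving the single-target problem, the expected running time on $G$ with target $t$ and approximation threshold $\delta$ is $\Omega(\min\{m,n/\delta\})$.
   Context: Fix a constant $\alpha\in(0,1)$. For a directed graph $G=(V,E)$, an $\alpha$-discounted random walk from $s$: at each step, with probability $\alpha$ it terminates at the current node, otherwise it moves to a uniformly random out-neighbor of the current node. $\pi(s,t)$ is the probability that such a walk from $s$ terminates at $t$. Adjacency-list model: an algorithm accesses $G$ only through constant-time queries $\texttt{DEG-IN}(u)$, $\texttt{DEG-OUT}(u)$ (in-/out-degree of $u$), $\texttt{IN}(u,i)$, $\texttt{OUT}(u,i)$ ($i$-th in-/out-neighbor of $u$). Additional queries: $\texttt{ADJ}(u,v)$ returns whether $(u,v)\in E$; $\texttt{IN-SORTED}(u,i)$ returns the $i$-th in-neighbor of $u$ when in-neighbors are sorted by out-degree; $\texttt{JUMP}()$ returns a uniformly random node of $V$. Single-target problem: given $G$ (via queries), a target $t\in V$ and $\delta\in(0,1]$, output estimates $\hat\pi(s,t)$ for all $s\in V$ such that for each $s$, $\Pr\{|\hat\pi(s,t)-\pi(s,t)|\ge\varepsilon\max\{\pi(s,t),\delta\}\}\le p_f$, where $\varepsilon,p_f$ are fixed small constants; an algorithm solves the problem if this holds for every input. 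*)

theory Defs
  imports "HOL-Probability.Probability" "Graph_Theory.Pair_Digraph"
begin

text \<open>
  Input graphs: finite digraphs without parallel arcs (self-loops are allowed). Every node has an
  out-neighbour, so that the discounted walk is well defined without a convention for dead ends.
\<close>

definition walkable_digraph :: "nat pair_pre_digraph \<Rightarrow> bool" where
  "walkable_digraph G \<longleftrightarrow>
     pair_fin_digraph G \<and> (\<forall>u\<in>pverts G. \<exists>v. (u, v) \<in> parcs G)"

partial_function (spmf) discounted_walk ::
  "real \<Rightarrow> nat pair_pre_digraph \<Rightarrow> nat \<Rightarrow> nat spmf" where
  "discounted_walk \<alpha> G u =
     bind_spmf (spmf_of_pmf (bernoulli_pmf \<alpha>)) (\<lambda>stop.
       if stop then return_spmf u
       else bind_spmf (spmf_of_set {v. (u, v) \<in> parcs G}) (\<lambda>v. discounted_walk \<alpha> G v))"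

definition ppr :: "real \<Rightarrow> nat pair_pre_digraph \<Rightarrow> nat \<Rightarrow> nat \<Rightarrow> real" where
  "ppr \<alpha> G s t = spmf (discounted_walk \<alpha> G s) t"


text \<open>
  The order of the neighbours in the lists, including the order among in-neighbours of equal
  out-degree in the sorted lists, is not determined by the graph.
\<close>

record adjacency =
  out_list :: "nat \<Rightarrow> nat list"
  in_list :: "nat \<Rightarrow> nat list"
  in_sorted_list :: "nat \<Rightarrow> nat list"

definition represents :: "adjacency \<Rightarrow> nat pair_pre_digraph \<Rightarrow> bool" where
  "represents R G \<longleftrightarrow> (\<forall>u.
     distinct (out_list R u) \<and> set (out_list R u) = {v. (u, v) \<in> parcs G} \<and>
     distinct (in_list R u) \<and> set (in_list R u) = {v. (v, u) \<in> parcs G} \<and>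
     distinct (in_sorted_list R u) \<and> set (in_sorted_list R u) = {v. (v, u) \<in> parcs G} \<and>
     sorted (map (out_degree (with_proj G)) (in_sorted_list R u)))"

datatype query =
    DEG_IN nat | DEG_OUT nat | IN nat nat | OUT nat nat
  | ADJ nat nat | IN_SORTED nat nat | JUMP

datatype answer = Number nat | Node "nat option" | Truth bool

text \<open>Neighbours are numbered from 1; an index out of range is answered by \<open>None\<close>.\<close>

definition ith :: "nat list \<Rightarrow> nat \<Rightarrow> nat option" where
  "ith xs i = (if 1 \<le> i \<and> i \<le> length xs then Some (xs ! (i - 1)) else None)"

fun respond :: "nat pair_pre_digraph \<Rightarrow> adjacency \<Rightarrow> query \<Rightarrow> answer pmf" where
  "respond G R (DEG_IN u) = return_pmf (Number (in_degree (with_proj G) u))"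
| "respond G R (DEG_OUT u) = return_pmf (Number (out_degree (with_proj G) u))"
| "respond G R (IN u i) = return_pmf (Node (ith (in_list R u) i))"
| "respond G R (OUT u i) = return_pmf (Node (ith (out_list R u) i))"
| "respond G R (ADJ u v) = return_pmf (Truth ((u, v) \<in> parcs G))"
| "respond G R (IN_SORTED u i) = return_pmf (Node (ith (in_sorted_list R u) i))"
| "respond G R JUMP = map_pmf (\<lambda>v. Node (Some v)) (pmf_of_set (pverts G))"


text \<open>
  A randomized algorithm chooses its next action at random, depending on everything that happened
  so far: it asks a query, performs a step of local computation (whose outcome, e.g. a coin toss,
  is recorded as a number), or stops and outputs an estimate for every node. Each query and each
  local step takes one unit of time. Local computation that is not declared as a step is
  free, so the number of queries is covered as a special case of the running time.

  Besides the target and the threshold, an algorithm is told the node set and the number of edges;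
  everything else about the graph has to be learned through queries. Algorithms that do not know
  these data are the ones that ignore the first two arguments.
\<close>

datatype action = Query query | Local nat | Output "nat \<Rightarrow> real"

datatype event = Answered query answer | Computed nat

type_synonym strategy = "event list \<Rightarrow> action pmf"

type_synonym algorithm = "nat set \<Rightarrow> nat \<Rightarrow> nat \<Rightarrow> real \<Rightarrow> strategy"

partial_function (spmf) execute ::
  "(query \<Rightarrow> answer pmf) \<Rightarrow> strategy \<Rightarrow> event list \<Rightarrow> (event list \<times> (nat \<Rightarrow> real)) spmf" where
  "execute ora S h =
     bind_spmf (spmf_of_pmf (S h)) (\<lambda>a. case a of
         Query q \<Rightarrow> bind_spmf (spmf_of_pmf (ora q)) (\<lambda>r. execute ora S (h @ [Answered q r]))
       | Local x \<Rightarrow> execute ora S (h @ [Computed x])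
       | Output est \<Rightarrow> return_spmf (h, est))"

text \<open>The missing probability mass of \<open>run\<close> is the probability of not terminating.\<close>

definition run ::
  "algorithm \<Rightarrow> nat pair_pre_digraph \<Rightarrow> adjacency \<Rightarrow> nat \<Rightarrow> real \<Rightarrow>
     (event list \<times> (nat \<Rightarrow> real)) spmf" where
  "run A G R t \<delta> = execute (respond G R) (A (pverts G) (card (parcs G)) t \<delta>) []"

definition expected_running_time ::
  "algorithm \<Rightarrow> nat pair_pre_digraph \<Rightarrow> adjacency \<Rightarrow> nat \<Rightarrow> real \<Rightarrow> ennreal" where
  "expected_running_time A G R t \<delta> =
     (if lossless_spmf (run A G R t \<delta>)
      then \<integral>\<^sup>+ (h, est). ennreal (real (length h)) \<partial>measure_spmf (run A G R t \<delta>)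
      else \<infinity>)"

definition solves_single_target :: "real \<Rightarrow> real \<Rightarrow> real \<Rightarrow> algorithm \<Rightarrow> bool" where
  "solves_single_target \<alpha> \<epsilon> p\<^sub>f A \<longleftrightarrow>
     (\<forall>G R t \<delta>. walkable_digraph G \<and> represents R G \<and> t \<in> pverts G \<and> 0 < \<delta> \<and> \<delta> \<le> 1 \<longrightarrow>
        lossless_spmf (run A G R t \<delta>) \<and>
        (\<forall>s\<in>pverts G.
           measure (measure_spmf (run A G R t \<delta>))
             {(h, est). \<bar>est s - ppr \<alpha> G s t\<bar> \<ge> \<epsilon> * max (ppr \<alpha> G s t) \<delta>} \<le> p\<^sub>f))"

end

theory Submission
  imports Defs "HOL-Combinatorics.Transposition"
begin

text \<open>
  Take nodes \<open>U\<^sub>i\<close>, \<open>V\<^sub>i\<close>, \<open>W\<^sub>i\<close>, \<open>X\<^sub>i\<close> for \<open>i < n\<close> and a target \<open>t\<close>, with arcs \<open>U\<^sub>i \<rightarrow> V\<^sub>j\<close> and \<open>W\<^sub>i \<rightarrow> X\<^sub>j\<close> for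
  \<open>j < D\<close>, where \<open>D\<close> is about \<open>min (m / n) (1 / \<delta>)\<close>. Every \<open>X\<^sub>j\<close> leads to \<open>t\<close>, whereas nothing reachable from
  \<open>U\<^sub>i\<close> does, so \<open>\<pi>(U\<^sub>i, t) = 0\<close>. Replacing the arcs \<open>U\<^sub>i \<rightarrow> V\<^sub>j\<close>, \<open>W\<^sub>i \<rightarrow> X\<^sub>j\<close> by \<open>U\<^sub>i \<rightarrow> X\<^sub>j\<close>, \<open>W\<^sub>i \<rightarrow> V\<^sub>j\<close> keeps all
  degrees but raises \<open>\<pi>(U\<^sub>i, t)\<close> to the order of \<open>1 / D \<ge> \<delta>\<close>. A correct algorithm must therefore, already on the
  original graph, detect with constant probability that the swap \<open>(i, j)\<close> has not been made. The sets of queries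
  whose answers depend on the different swaps are disjoint, so the expected number of queries is \<open>\<Omega>(n D)\<close>.
\<close>

section \<open>Transcripts of one strategy under two oracles\<close>

text \<open>Used to discard every continuation whose next event disagrees with a prescribed
  transcript.\<close>

lemma execute_extends_history:
  "set_spmf (execute ora S h) \<subseteq> {(h', est). \<exists>es. h' = h @ es}"
proof (induction arbitrary: h rule: execute.fixp_induct)
  case 1
  show ?case by simp
next
  case 2
  show ?case by simp
next
  case (3 f)
  have step: "z \<in> {(h', est). \<exists>es. h' = h @ es}" if "z \<in> set_spmf (f ora S (h @ [e]))" for z e
    using 3[of "h @ [e]"] that by fastforce
  show ?case
    by (auto simp: set_bind_spmf bind_UNION simp del: bind_spmf_of_pmf split: action.splits dest!: step)
qed

text \<open>The mass of a fixed transcript is a product of action and answer probabilities along it,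
  so an oracle enters only through the queries recorded there.\<close>

lemma spmf_execute_cong_history:
  assumes "\<forall>q r. Answered q r \<in> set es \<longrightarrow> ora q = ora' q"
  shows "spmf (execute ora S h) (h @ es, est) = spmf (execute ora' S h) (h @ es, est)"
  using assms
proof (induction es arbitrary: h)
  case (Cons e es)
  have other: "spmf (execute o' S (h @ [e'])) (h @ e # es, est) = 0" if "e' \<noteq> e" for o' e'
    using execute_extends_history[of o' S "h @ [e']"] that by (auto simp: spmf_eq_0_set_spmf)
  have same: "spmf (execute ora S (h @ [e'])) (h @ e # es, est) =
      spmf (execute ora' S (h @ [e'])) (h @ e # es, est)" for e'
    using Cons.IH[of "h @ [e]"] Cons.prems other[of e'] by (cases "e' = e") auto
  have "spmf (spmf_of_pmf (ora q) \<bind> (\<lambda>r. execute ora S (h @ [Answered q r]))) (h @ e # es, est) =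
     spmf (spmf_of_pmf (ora' q) \<bind> (\<lambda>r. execute ora' S (h @ [Answered q r]))) (h @ e # es, est)" for q
  proof (cases "\<exists>r. e = Answered q r")
    case True
    then have "ora q = ora' q" using Cons.prems by auto
    then show ?thesis by (simp add: spmf_bind same del: bind_spmf_of_pmf)
  next
    case False
    then have "Answered q r \<noteq> e" for r by auto
    then show ?thesis by (simp add: spmf_bind other del: bind_spmf_of_pmf)
  qed
  then show ?case
    by (subst (1 2) execute.simps)
      (auto simp: spmf_bind simp del: bind_spmf_of_pmf intro!: Bochner_Integration.integral_cong same split: action.split)
next
  case Nil
  \<comment> \<open>With no events left, only an immediate output contributes: any other action
    lengthens the history for good.\<close>
  have later: "spmf (execute o' S (h @ [e])) (h, est) = 0" for o' e
    using execute_extends_history[of o' S "h @ [e]"] by (auto simp: spmf_eq_0_set_spmf)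
  show ?case
    by (subst (1 2) execute.simps)
      (auto simp: spmf_bind later simp del: bind_spmf_of_pmf intro!: Bochner_Integration.integral_cong split: action.split)
qed

lemma measure_spmf_cong_spmf:
  assumes "\<And>x. x \<in> A \<Longrightarrow> spmf p x = spmf q x"
  shows "measure (measure_spmf p) A = measure (measure_spmf q) A"
proof -
  have "emeasure (measure_spmf p) A = emeasure (measure_spmf q) A"
    using assms
    by (auto simp: nn_integral_indicator[symmetric] nn_integral_measure_spmf
        simp del: nn_integral_indicator intro!: nn_integral_cong split: split_indicator)
  then show ?thesis by (simp add: measure_def)
qed

text \<open>Transcripts on which all answers agree are equally likely on both inputs, so among them
  an output wrong for \<open>G'\<close> has mass at most \<open>p\<close> on \<open>G\<close> too.
  Only the run on \<open>G\<close> is measured, so one run can be tested against many graphs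
  \<open>G'\<close>.\<close>

lemma run_distinguishes:
  assumes A: "solves_single_target \<alpha> \<epsilon> p A"
    and G: "walkable_digraph G" "represents R G"
    and G': "walkable_digraph G'" "represents R' G'"
    and same: "pverts G' = pverts G" "card (parcs G') = card (parcs G)"
    and s: "s \<in> pverts G" and t: "t \<in> pverts G" and \<delta>: "0 < \<delta>" "\<delta> \<le> 1"
    and gap: "\<bar>ppr \<alpha> G s t - ppr \<alpha> G' s t\<bar> \<ge>
      \<epsilon> * max (ppr \<alpha> G s t) \<delta> + \<epsilon> * max (ppr \<alpha> G' s t) \<delta>"
  shows "measure (measure_spmf (run A G R t \<delta>))
      {(h, est). \<exists>q r. Answered q r \<in> set h \<and> respond G R q \<noteq> respond G' R' q} \<ge> 1 - 2 * p"
    (is "measure ?M ?touch \<ge> _")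
proof -
  let ?M' = "measure_spmf (run A G' R' t \<delta>)"
  define wrong where "wrong H = {(h :: event list, est :: nat \<Rightarrow> real).
    \<bar>est s - ppr \<alpha> H s t\<bar> \<ge> \<epsilon> * max (ppr \<alpha> H s t) \<delta>}" for H
  have lossless: "lossless_spmf (run A G R t \<delta>)" and w: "measure ?M (wrong G) \<le> p"
    using A G s t \<delta> by (auto simp: solves_single_target_def wrong_def)
  have w': "measure ?M' (wrong G') \<le> p"
    using A G' s t \<delta> same by (auto simp: solves_single_target_def wrong_def)
  have "spmf (run A G R t \<delta>) z = spmf (run A G' R' t \<delta>) z" if "z \<in> wrong G' - ?touch" for z
    using that
      spmf_execute_cong_history[of "fst z" "respond G R" "respond G' R'" _ "[]" "snd z"]
    by (cases z) (auto simp: run_def same)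
  then have eq: "measure ?M (wrong G' - ?touch) = measure ?M' (wrong G' - ?touch)"
    by (rule measure_spmf_cong_spmf)
  \<comment> \<open>By the triangle inequality, \<open>gap\<close> forbids one estimate within
    tolerance of both values.\<close>
  have cover: "UNIV = ?touch \<union> wrong G \<union> (wrong G' - ?touch)"
    using gap by (auto simp: wrong_def)
  have "1 = measure ?M UNIV"
    using lossless by (simp add: lossless_spmf_def weight_spmf_def)
  also have "\<dots> \<le> measure ?M (?touch \<union> wrong G) + measure ?M (wrong G' - ?touch)"
    unfolding cover by (rule measure_Un_le) auto
  also have "measure ?M (?touch \<union> wrong G) \<le> measure ?M ?touch + measure ?M (wrong G)"
    by (rule measure_Un_le) auto
  also have "measure ?M (wrong G' - ?touch) \<le> measure ?M' (wrong G')"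
    unfolding eq by (rule measure_spmf.finite_measure_mono) auto
  finally show ?thesis using w w' by simp
qed

section \<open>From detection probabilities to expected time\<close>

text \<open>An event carries at most one key, so a history is at least as long as the number of keys
  it shows; linearity of expectation then adds the probabilities without any independence.\<close>

lemma expected_length_ge_keys:
  fixes p :: "(event list \<times> 'b) spmf" and key :: "event \<Rightarrow> 'k option"
  assumes "finite K"
    and prob: "\<And>k. k \<in> K \<Longrightarrow> measure (measure_spmf p) {(h, est). Some k \<in> key ` set h} \<ge> c"
    and c: "0 \<le> c"
  shows "(\<integral>\<^sup>+ (h, est). ennreal (real (length h)) \<partial>measure_spmf p) \<ge> ennreal (c * card K)"
proof -
  have count: "(\<Sum>k\<in>K. indicator {(h, est). Some k \<in> key ` set h} z) \<le> ennreal (real (length (fst z)))" for z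
  proof -
    let ?K = "{k \<in> K. Some k \<in> key ` set (fst z)}"
    have "card ?K = card (Some ` ?K)" by (simp add: card_image)
    also have "\<dots> \<le> card (key ` set (fst z))" by (rule card_mono) auto
    also have "\<dots> \<le> length (fst z)" by (meson card_image_le card_length finite_set le_trans)
    finally have "card ?K \<le> length (fst z)" .
    moreover have "(\<Sum>k\<in>K. indicator {(h, est). Some k \<in> key ` set h} z) = (of_nat (card ?K) :: ennreal)"
      using \<open>finite K\<close> by (cases z) (auto simp: indicator_def sum.If_cases Int_def)
    ultimately show ?thesis by (simp add: ennreal_of_nat_eq_real_of_nat)
  qed
  have "ennreal (c * card K) = (\<Sum>k\<in>K. ennreal c)"
    using c by (simp add: ennreal_mult' ennreal_of_nat_eq_real_of_nat mult.commute)
  also have "\<dots> \<le> (\<Sum>k\<in>K. emeasure (measure_spmf p) {(h, est). Some k \<in> key ` set h})"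
    using prob by (intro sum_mono) (simp add: measure_spmf.emeasure_eq_measure)
  also have "\<dots> = (\<integral>\<^sup>+ z. (\<Sum>k\<in>K. indicator {(h, est). Some k \<in> key ` set h} z) \<partial>measure_spmf p)"
    by (subst nn_integral_sum) auto
  also have "\<dots> \<le> (\<integral>\<^sup>+ z. ennreal (real (length (fst z))) \<partial>measure_spmf p)"
    by (intro nn_integral_mono count)
  finally show ?thesis by (simp add: case_prod_unfold)
qed

section \<open>Bounds on walk probabilities\<close>

text \<open>Conditioning on the first step. At a dead end the walk loses its mass, matching
  \<open>0 / 0 = 0\<close> on the right.\<close>

lemma ppr_unfold:
  assumes "0 \<le> \<alpha>" "\<alpha> \<le> 1" "finite {v. (u, v) \<in> parcs G}"
  shows "ppr \<alpha> G u t = \<alpha> * of_bool (u = t) +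
    (1 - \<alpha>) * ((\<Sum>v | (u, v) \<in> parcs G. ppr \<alpha> G v t) / card {v. (u, v) \<in> parcs G})"
  using assms unfolding ppr_def
  by (subst discounted_walk.simps) (simp add: spmf_bind integral_spmf_of_set del: bind_spmf_of_pmf)

lemma ppr_nonneg: "ppr \<alpha> G u t \<ge> 0"
  by (simp add: ppr_def)

lemma ppr_ge_step:
  assumes "0 \<le> \<alpha>" "\<alpha> \<le> 1" "finite {v. (u, v) \<in> parcs G}" "(u, v) \<in> parcs G"
  shows "ppr \<alpha> G u t \<ge> (1 - \<alpha>) * (ppr \<alpha> G v t / card {v. (u, v) \<in> parcs G})"
proof -
  have "ppr \<alpha> G v t \<le> (\<Sum>v | (u, v) \<in> parcs G. ppr \<alpha> G v t)"
    using assms by (intro member_le_sum) (auto simp: ppr_nonneg)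
  then have "(1 - \<alpha>) * (ppr \<alpha> G v t / card {v. (u, v) \<in> parcs G}) \<le>
      (1 - \<alpha>) * ((\<Sum>v | (u, v) \<in> parcs G. ppr \<alpha> G v t) / card {v. (u, v) \<in> parcs G})"
    using assms by (intro mult_left_mono divide_right_mono) auto
  then show ?thesis using assms by (subst ppr_unfold) auto
qed

text \<open>A walk cannot leave \<open>C\<close>, so it stops inside \<open>C\<close> if at all;
  fixpoint induction makes this precise.\<close>

lemma ppr_eq_0_of_closed:
  assumes "\<And>u v. u \<in> C \<Longrightarrow> (u, v) \<in> parcs G \<Longrightarrow> v \<in> C" and "t \<notin> C" and "u \<in> C"
    and "finite (parcs G)"
  shows "ppr \<alpha> G u t = 0"
proof -
  have fin: "finite {v. (u, v) \<in> parcs G}" for u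
    using finite_imageI[OF assms(4), of snd] by (rule rev_finite_subset) force
  have "set_spmf (discounted_walk \<alpha> G u) \<subseteq> C" if "u \<in> C" for u
    using that
  proof (induction arbitrary: u rule: discounted_walk.fixp_induct)
    case (3 f)
    then show ?case
      using assms(1) by (fastforce simp: set_bind_spmf bind_UNION fin simp del: bind_spmf_of_pmf split: if_splits)
  qed simp_all
  then show ?thesis
    using assms(2,3) by (auto simp: ppr_def spmf_eq_0_set_spmf)
qed

section \<open>Swapping the heads of two arcs\<close>

lemma out_degree_eq_card: "out_degree (with_proj G) u = card {v. (u, v) \<in> parcs G}"
proof -
  have "out_arcs (with_proj G) u = Pair u ` {v. (u, v) \<in> parcs G}"
    by (auto simp: out_arcs_def)
  then show ?thesis by (simp add: out_degree_def card_image inj_on_def)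
qed

lemma in_degree_eq_card: "in_degree (with_proj G) v = card {u. (u, v) \<in> parcs G}"
proof -
  have "in_arcs (with_proj G) v = (\<lambda>u. (u, v)) ` {u. (u, v) \<in> parcs G}"
    by (auto simp: in_arcs_def)
  then show ?thesis by (simp add: in_degree_def card_image inj_on_def)
qed

lemma ith_map: "ith (map f xs) i = map_option f (ith xs i)"
  by (auto simp: ith_def)

text \<open>The one node pair, tail first, about which a query is informative. It is read off the
  lists of the original graph, so the same function serves every swap. Degree and
  \<open>JUMP\<close> queries get no pair because swaps do not affect them.\<close>

fun probed_pair :: "adjacency \<Rightarrow> query \<Rightarrow> (nat \<times> nat) option" where
  "probed_pair R (OUT u i) = map_option (\<lambda>v. (u, v)) (ith (out_list R u) i)"
| "probed_pair R (IN v i) = map_option (\<lambda>u. (u, v)) (ith (in_list R v) i)"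
| "probed_pair R (IN_SORTED v i) = map_option (\<lambda>u. (u, v)) (ith (in_sorted_list R v) i)"
| "probed_pair R (ADJ u v) = Some (u, v)"
| "probed_pair R _ = None"

text \<open>\<open>non_arcs\<close> ensures that no arc is duplicated or lost, and
  \<open>same_degree\<close> that the lists sorted by out-degree stay sorted.\<close>

locale arc_swap =
  fixes G :: "nat pair_pre_digraph" and u v w x :: nat
  assumes walkable: "walkable_digraph G"
    and arcs: "(u, v) \<in> parcs G" "(w, x) \<in> parcs G"
    and non_arcs: "(u, x) \<notin> parcs G" "(w, v) \<notin> parcs G"
    and same_degree: "out_degree (with_proj G) u = out_degree (with_proj G) w"
begin

definition swapped :: "nat pair_pre_digraph" where
  "swapped = G\<lparr>parcs := parcs G - {(u, v), (w, x)} \<union> {(u, x), (w, v)}\<rparr>"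

text \<open>Of \<open>v\<close> and \<open>x\<close>, node \<open>u\<close> has only
  \<open>v\<close> as out-neighbour and \<open>w\<close> only \<open>x\<close>, so the transposition
  replaces one entry in place and leaves all other positions alone. In-lists behave
  likewise.\<close>

definition swapped_lists :: "adjacency \<Rightarrow> adjacency" where
  "swapped_lists R = \<lparr>
     out_list = (\<lambda>a. if a \<in> {u, w} then map (Transposition.transpose v x) (out_list R a) else out_list R a),
     in_list = (\<lambda>b. if b \<in> {v, x} then map (Transposition.transpose u w) (in_list R b) else in_list R b),
     in_sorted_list = (\<lambda>b. if b \<in> {v, x} then map (Transposition.transpose u w) (in_sorted_list R b)
       else in_sorted_list R b)\<rparr>"

lemma distinct_ends: "u \<noteq> w" "v \<noteq> x"
  using arcs non_arcs by auto

lemma pverts_swapped [simp]: "pverts swapped = pverts G"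
  by (simp add: swapped_def)

lemma parcs_swapped: "parcs swapped = parcs G - {(u, v), (w, x)} \<union> {(u, x), (w, v)}"
  by (simp add: swapped_def)

lemma out_neighbours_swapped:
  "{b. (a, b) \<in> parcs swapped} =
    (if a \<in> {u, w} then Transposition.transpose v x ` {b. (a, b) \<in> parcs G} else {b. (a, b) \<in> parcs G})"
  using distinct_ends arcs non_arcs
  by (auto simp: parcs_swapped image_iff Transposition.transpose_def)

lemma in_neighbours_swapped:
  "{a. (a, b) \<in> parcs swapped} =
    (if b \<in> {v, x} then Transposition.transpose u w ` {a. (a, b) \<in> parcs G} else {a. (a, b) \<in> parcs G})"
  using distinct_ends arcs non_arcs
  by (auto simp: parcs_swapped image_iff Transposition.transpose_def)

lemma card_out_neighbours_swapped:
  "card {b. (a, b) \<in> parcs swapped} = card {b. (a, b) \<in> parcs G}"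
  by (simp add: out_neighbours_swapped card_image)

lemma out_degree_swapped: "out_degree (with_proj swapped) = out_degree (with_proj G)"
  by (simp add: fun_eq_iff out_degree_eq_card card_out_neighbours_swapped)

lemma in_degree_swapped: "in_degree (with_proj swapped) = in_degree (with_proj G)"
  by (simp add: fun_eq_iff in_degree_eq_card in_neighbours_swapped card_image)

lemma finite_arcs: "finite (parcs G)"
  using walkable by (simp add: walkable_digraph_def pair_fin_digraph_def pair_fin_digraph_axioms_def)

lemma card_parcs_swapped: "card (parcs swapped) = card (parcs G)"
proof -
  have "card (parcs swapped) = card (parcs G - {(u, v), (w, x)}) + card {(u, x), (w, v)}"
    unfolding parcs_swapped using finite_arcs non_arcs by (intro card_Un_disjoint) auto
  moreover have "card (parcs G) = card (parcs G - {(u, v), (w, x)}) + card {(u, v), (w, x)}"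
    using finite_arcs arcs by (subst card_Diff_subset) (auto simp: card_mono)
  ultimately show ?thesis using distinct_ends by simp
qed

lemma walkable_swapped: "walkable_digraph swapped"
proof -
  have fin: "pair_fin_digraph G" and out: "\<forall>a\<in>pverts G. \<exists>b. (a, b) \<in> parcs G"
    using walkable by (auto simp: walkable_digraph_def)
  interpret pair_fin_digraph G by (fact fin)
  have "pair_fin_digraph swapped"
    by standard (use arcs in \<open>auto simp: parcs_swapped dest: arc_fst_in_verts arc_snd_in_verts\<close>)
  moreover have "\<exists>b. (a, b) \<in> parcs swapped" if "a \<in> pverts G" for a
    using out that out_neighbours_swapped[of a] by (cases "a \<in> {u, w}") auto
  ultimately show ?thesis by (auto simp: walkable_digraph_def)
qed

lemma represents_swapped:
  assumes "represents R G"
  shows "represents (swapped_lists R) swapped"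
proof -
  have "out_degree (with_proj G) (Transposition.transpose u w a) = out_degree (with_proj G) a" for a
    using same_degree by (auto simp: Transposition.transpose_def)
  then have "map (out_degree (with_proj G)) (in_sorted_list (swapped_lists R) b) =
      map (out_degree (with_proj G)) (in_sorted_list R b)" for b
    by (auto simp: swapped_lists_def)
  then show ?thesis
    using assms unfolding represents_def out_neighbours_swapped in_neighbours_swapped out_degree_swapped
    by (simp add: swapped_lists_def distinct_map)
qed

text \<open>A list answer changes only if it names a transposed node in one of the altered lists.
  For \<open>ADJ\<close>, the two removed and two added arcs are exactly the four pairs in
  question.\<close>

lemma respond_swapped:
  assumes "respond G R q \<noteq> respond swapped (swapped_lists R) q"
  shows "\<exists>a\<in>{u, w}. \<exists>b\<in>{v, x}. probed_pair R q = Some (a, b)"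
proof -
  have *: "\<exists>y. z = Some y \<and> y \<in> {c, d}" if "z \<noteq> map_option (Transposition.transpose c d) z" for z and c d :: nat
    using that by (cases z) (auto simp: Transposition.transpose_def split: if_splits)
  show ?thesis
    using assms
    by (cases q) (auto simp: swapped_lists_def ith_map out_degree_swapped in_degree_swapped parcs_swapped
        split: if_splits dest!: *)
qed

end

section \<open>The hard graph and its swaps\<close>

text \<open>
  For \<open>i < n\<close>, the numbers \<open>4 i\<close>, \<open>4 i + 1\<close>, \<open>4 i + 2\<close>, \<open>4 i + 3\<close> stand for \<open>U\<^sub>i\<close>, \<open>V\<^sub>i\<close>, \<open>W\<^sub>i\<close>, \<open>X\<^sub>i\<close>,
  and \<open>4 n\<close> is the target. The arcs among the \<open>V\<^sub>i\<close> only pad the number of edges.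
\<close>

definition hard_graph :: "nat \<Rightarrow> nat \<Rightarrow> nat \<Rightarrow> nat pair_pre_digraph" where
  "hard_graph n D d = \<lparr>pverts = {..4 * n},
     parcs = (\<lambda>(i, j). (4 * i, 4 * j + 1)) ` ({..<n} \<times> {..<D}) \<union>
       (\<lambda>(i, j). (4 * i + 2, 4 * j + 3)) ` ({..<n} \<times> {..<D}) \<union>
       (\<lambda>(i, j). (4 * i + 1, 4 * j + 1)) ` ({..<n} \<times> {..<d}) \<union>
       (\<lambda>i. (4 * i + 3, 4 * n)) ` {..<n} \<union> {(4 * n, 4 * n)}\<rparr>"

lemma pverts_hard_graph [simp]: "pverts (hard_graph n D d) = {..4 * n}"
  by (simp add: hard_graph_def)

lemma mem_parcs_hard_graph:
  "(a, b) \<in> parcs (hard_graph n D d) \<longleftrightarrow>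
    (\<exists>i<n. \<exists>j<D. a = 4 * i \<and> b = 4 * j + 1) \<or>
    (\<exists>i<n. \<exists>j<D. a = 4 * i + 2 \<and> b = 4 * j + 3) \<or>
    (\<exists>i<n. \<exists>j<d. a = 4 * i + 1 \<and> b = 4 * j + 1) \<or>
    (\<exists>i<n. a = 4 * i + 3 \<and> b = 4 * n) \<or> a = 4 * n \<and> b = 4 * n"
  by (auto simp: hard_graph_def image_iff)

text \<open>The padding arcs alone give the lower bound; the upper bound is a union bound.\<close>

lemma card_parcs_hard_graph:
  "n * d \<le> card (parcs (hard_graph n D d))"
  "card (parcs (hard_graph n D d)) \<le> 2 * (n * D) + n * d + n + 1"
proof -
  let ?A = "(\<lambda>(i, j). (4 * i, 4 * j + 1)) ` ({..<n} \<times> {..<D})"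
  let ?B = "(\<lambda>(i, j). (4 * i + 2, 4 * j + 3)) ` ({..<n} \<times> {..<D})"
  let ?C = "(\<lambda>(i, j). (4 * i + 1, 4 * j + 1)) ` ({..<n} \<times> {..<d})"
  let ?E = "(\<lambda>i. (4 * i + 3, 4 * n)) ` {..<n}"
  let ?F = "{(4 * n, 4 * n)}"
  have eq: "parcs (hard_graph n D d) = ?A \<union> ?B \<union> ?C \<union> ?E \<union> ?F"
    by (simp add: hard_graph_def)
  have "n * d = card ?C" by (subst card_image) (auto simp: inj_on_def)
  also have "\<dots> \<le> card (parcs (hard_graph n D d))"
    unfolding eq by (rule card_mono) auto
  finally show "n * d \<le> card (parcs (hard_graph n D d))" .
  have "card ?A \<le> n * D" "card ?B \<le> n * D" "card ?C \<le> n * d" "card ?E \<le> n"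
    using card_image_le[of "{..<n} \<times> {..<D}"] card_image_le[of "{..<n} \<times> {..<d}"]
      card_image_le[of "{..<n}"] by (simp_all add: card_cartesian_product)
  moreover have "card (parcs (hard_graph n D d)) \<le> card ?A + card ?B + card ?C + card ?E + card ?F"
    unfolding eq by (meson card_Un_le add_le_mono1 order_trans)
  ultimately show "card (parcs (hard_graph n D d)) \<le> 2 * (n * D) + n * d + n + 1" by simp
qed

lemma walkable_hard_graph:
  assumes "0 < D" "0 < d" "D \<le> n" "d \<le> n"
  shows "walkable_digraph (hard_graph n D d)"
proof -
  have "pair_fin_digraph (hard_graph n D d)"
  proof
    show "finite (parcs (hard_graph n D d))" by (simp add: hard_graph_def)
  qed (use assms in \<open>auto simp: mem_parcs_hard_graph\<close>)
  moreover have "\<exists>b. (a, b) \<in> parcs (hard_graph n D d)" if "a \<le> 4 * n" for a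
  proof (cases "a = 4 * n")
    case False
    then have "a div 4 < n" using that by auto
    moreover have "a = 4 * (a div 4) \<or> a = 4 * (a div 4) + 1 \<or> a = 4 * (a div 4) + 2 \<or>
      a = 4 * (a div 4) + 3" by presburger
    ultimately show ?thesis using assms(1,2) unfolding mem_parcs_hard_graph by blast
  qed (auto simp: mem_parcs_hard_graph)
  ultimately show ?thesis by (simp add: walkable_digraph_def)
qed

lemma out_neighbours_hard_graph:
  assumes "i < n"
  shows "{b. (4 * i, b) \<in> parcs (hard_graph n D d)} = (\<lambda>j. 4 * j + 1) ` {..<D}"
    and "{b. (4 * i + 2, b) \<in> parcs (hard_graph n D d)} = (\<lambda>j. 4 * j + 3) ` {..<D}"
    and "{b. (4 * i + 3, b) \<in> parcs (hard_graph n D d)} = {4 * n}"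
  using assms by (auto simp: mem_parcs_hard_graph; presburger)+

lemma card_out_neighbours_hard_graph:
  assumes "i < n"
  shows "card {b. (4 * i, b) \<in> parcs (hard_graph n D d)} = D"
    and "card {b. (4 * i + 2, b) \<in> parcs (hard_graph n D d)} = D"
  unfolding out_neighbours_hard_graph[OF assms] by (simp_all add: card_image inj_on_def)

lemma arc_swap_hard_graph:
  assumes "0 < d" "D \<le> n" "d \<le> n" "i < n" "j < D"
  shows "arc_swap (hard_graph n D d) (4 * i) (4 * j + 1) (4 * i + 2) (4 * j + 3)"
proof
  show "walkable_digraph (hard_graph n D d)" using assms by (intro walkable_hard_graph) auto
  show "out_degree (with_proj (hard_graph n D d)) (4 * i) =
      out_degree (with_proj (hard_graph n D d)) (4 * i + 2)"
    using assms(4) by (simp only: out_degree_eq_card card_out_neighbours_hard_graph)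
qed (use assms in \<open>auto simp: mem_parcs_hard_graph; presburger\<close>)+

lemma ppr_hard_graph:
  assumes "i < n"
  shows "ppr \<alpha> (hard_graph n D d) (4 * i) (4 * n) = 0"
proof (rule ppr_eq_0_of_closed)
  \<comment> \<open>The numbers \<open>4 * i + 1\<close> contain all \<open>V\<^sub>i\<close>, whose
    arcs stay among the \<open>V\<^sub>j\<close>.\<close>
  let ?C = "(\<lambda>i. 4 * i) ` {..<n} \<union> range (\<lambda>i. 4 * i + 1)"
  show "b \<in> ?C" if "a \<in> ?C" "(a, b) \<in> parcs (hard_graph n D d)" for a b
    using that unfolding mem_parcs_hard_graph by (auto; presburger)
  show "4 * n \<notin> ?C" by (auto; presburger)
  show "4 * i \<in> ?C" using assms by auto
  show "finite (parcs (hard_graph n D d))" by (simp add: hard_graph_def)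
qed

text \<open>The bound is the probability of the single walk from \<open>U\<^sub>i\<close> via
  \<open>X\<^sub>j\<close> to the target that stops on first arrival: \<open>U\<^sub>i\<close> still
  has \<open>D\<close> out-neighbours, and \<open>X\<^sub>j\<close> has only one.\<close>

lemma ppr_swapped_hard_graph:
  assumes \<alpha>: "0 < \<alpha>" "\<alpha> < 1" and bounds: "0 < d" "D \<le> n" "d \<le> n" "i < n" "j < D"
  shows "ppr \<alpha> (arc_swap.swapped (hard_graph n D d) (4 * i) (4 * j + 1) (4 * i + 2) (4 * j + 3))
    (4 * i) (4 * n) \<ge> \<alpha> * (1 - \<alpha>)\<^sup>2 / D"
proof -
  interpret arc_swap "hard_graph n D d" "4 * i" "4 * j + 1" "4 * i + 2" "4 * j + 3"
    using bounds by (rule arc_swap_hard_graph)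
  have fin: "finite {b. (a, b) \<in> parcs swapped}" for a
  proof -
    have "finite (parcs swapped)" unfolding parcs_swapped using finite_arcs by simp
    from finite_imageI[OF this, of snd] show ?thesis by (rule rev_finite_subset) force
  qed
  have arc: "(4 * i, 4 * j + 3) \<in> parcs swapped" unfolding parcs_swapped by simp
  have x: "{b. (4 * j + 3, b) \<in> parcs swapped} = {4 * n}"
    using out_neighbours_hard_graph(3)[of j n D d] bounds
    unfolding out_neighbours_swapped by (auto; presburger)
  have "ppr \<alpha> swapped (4 * n) (4 * n) \<ge> \<alpha>"
    using \<alpha> fin by (subst ppr_unfold) (auto intro!: mult_nonneg_nonneg divide_nonneg_nonneg sum_nonneg ppr_nonneg)
  then have "(1 - \<alpha>) * \<alpha> \<le> (1 - \<alpha>) * ppr \<alpha> swapped (4 * n) (4 * n)"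
    using \<alpha> by (intro mult_left_mono) auto
  also have "\<dots> \<le> ppr \<alpha> swapped (4 * j + 3) (4 * n)"
    using ppr_ge_step[of \<alpha> "4 * j + 3" swapped "4 * n" "4 * n"] \<alpha> fin x by auto
  finally have "(1 - \<alpha>) * ((1 - \<alpha>) * \<alpha> / D) \<le> (1 - \<alpha>) * (ppr \<alpha> swapped (4 * j + 3) (4 * n) / D)"
    using \<alpha> by (intro mult_left_mono divide_right_mono) auto
  also have "\<dots> \<le> ppr \<alpha> swapped (4 * i) (4 * n)"
    using ppr_ge_step[OF _ _ fin arc, of \<alpha> "4 * n"] \<alpha>
    unfolding card_out_neighbours_swapped card_out_neighbours_hard_graph(1)[OF \<open>i < n\<close>]
    by auto
  finally show ?thesis by (simp add: power2_eq_square mult_ac)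
qed

section \<open>The running time bound and the choice of parameters\<close>

lemma expected_running_time_hard_graph:
  fixes \<alpha> \<epsilon> p \<delta> :: real
  assumes \<alpha>: "0 < \<alpha>" "\<alpha> < 1" and \<epsilon>: "0 < \<epsilon>" "\<epsilon> \<le> \<alpha> * (1 - \<alpha>)\<^sup>2 / 2" and p: "p \<le> 1 / 4"
    and bounds: "0 < D" "0 < d" "D \<le> n" "d \<le> n" and \<delta>: "0 < \<delta>" "\<delta> * D \<le> 1"
    and A: "solves_single_target \<alpha> \<epsilon> p A" and R: "represents R (hard_graph n D d)"
  shows "expected_running_time A (hard_graph n D d) R (4 * n) \<delta> \<ge> ennreal (n * D / 2)"
proof -
  let ?G = "hard_graph n D d"
  let ?p = "run A ?G R (4 * n) \<delta>"
  \<comment> \<open>Division by 4 maps \<open>4 * i\<close> and \<open>4 * i + 2\<close> to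
    \<open>i\<close>, and \<open>4 * j + 1\<close> and \<open>4 * j + 3\<close> to \<open>j\<close>.
    Hence the four pairs of swap \<open>(i, j)\<close> share the key \<open>(i, j)\<close>, and
    different swaps have different keys.\<close>
  define key where "key e = (case e of Answered q r \<Rightarrow>
    map_option (\<lambda>(a, b). (a div 4, b div 4)) (probed_pair R q) | Computed _ \<Rightarrow> None)" for e
  have "\<delta> * 1 \<le> \<delta> * D" using \<delta> bounds by (intro mult_left_mono) auto
  then have \<delta>1: "\<delta> \<le> 1" using \<delta>(2) by linarith
  have \<epsilon>2: "\<epsilon> \<le> 1 / 2"
  proof -
    have "\<alpha> * (1 - \<alpha>)\<^sup>2 \<le> 1 * 1" using \<alpha> by (intro mult_mono power_le_one) auto
    then show ?thesis using \<epsilon> by simp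
  qed
  have lossless: "lossless_spmf ?p"
    using A R walkable_hard_graph[OF bounds] \<delta> \<delta>1 by (auto simp: solves_single_target_def)
  have prob: "measure (measure_spmf ?p) {(h, est). Some k \<in> key ` set h} \<ge> 1 / 2"
    if k: "k \<in> {..<n} \<times> {..<D}" for k
  proof -
    obtain i j where k_eq: "k = (i, j)" and ij: "i < n" "j < D" using k by auto
    interpret arc_swap ?G "4 * i" "4 * j + 1" "4 * i + 2" "4 * j + 3"
      using bounds ij by (intro arc_swap_hard_graph)
    let ?\<pi> = "ppr \<alpha> swapped (4 * i) (4 * n)"
    \<comment> \<open>The bound on \<epsilon> is chosen for this: with \<delta> at most
      \<open>1 / D\<close>, the swapped value is at least twice the additive tolerance.\<close>
    have "2 * \<epsilon> * \<delta> \<le> \<alpha> * (1 - \<alpha>)\<^sup>2 * \<delta>" using \<epsilon> \<delta> by (intro mult_right_mono) auto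
    also have "\<dots> \<le> \<alpha> * (1 - \<alpha>)\<^sup>2 * (1 / D)"
      using \<alpha> \<delta> bounds by (intro mult_left_mono) (auto simp: field_simps)
    also have "\<dots> \<le> ?\<pi>" using ppr_swapped_hard_graph[OF \<alpha> bounds(2-4) ij] by simp
    finally have low: "\<epsilon> * \<delta> + \<epsilon> * \<delta> \<le> ?\<pi>" by (simp only: mult_2 ring_distribs)
    have "\<epsilon> * \<delta> + \<epsilon> * max ?\<pi> \<delta> \<le> ?\<pi>"
    proof (cases "?\<pi> \<le> \<delta>")
      \<comment> \<open>Above the threshold the tolerance is relative, and each of the two terms is
        at most half of \<open>?\<pi>\<close>.\<close>
      case False
      then have "\<epsilon> * \<delta> \<le> 1 / 2 * ?\<pi>" "\<epsilon> * ?\<pi> \<le> 1 / 2 * ?\<pi>"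
        using \<epsilon> \<epsilon>2 \<delta> by (intro mult_mono; simp)+
      then show ?thesis using False by simp
    qed (use low in \<open>simp only: max_absorb2\<close>)
    then have gap: "\<epsilon> * max (ppr \<alpha> ?G (4 * i) (4 * n)) \<delta> + \<epsilon> * max ?\<pi> \<delta> \<le>
        \<bar>ppr \<alpha> ?G (4 * i) (4 * n) - ?\<pi>\<bar>"
      using \<delta> ij by (simp add: ppr_hard_graph)
    have "1 / 2 \<le> 1 - 2 * p" using p by simp
    also have "\<dots> \<le> measure (measure_spmf ?p)
      {(h, est). \<exists>q r. Answered q r \<in> set h \<and> respond ?G R q \<noteq> respond swapped (swapped_lists R) q}"
      by (rule run_distinguishes[OF A walkable R walkable_swapped represents_swapped[OF R]
            pverts_swapped card_parcs_swapped _ _ \<delta>(1) \<delta>1 gap]) (use ij in auto)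
    also have "\<dots> \<le> measure (measure_spmf ?p) {(h, est). Some k \<in> key ` set h}"
    proof (intro measure_spmf.finite_measure_mono subsetI)
      fix z assume "z \<in> {(h, est). \<exists>q r. Answered q r \<in> set h \<and>
        respond ?G R q \<noteq> respond swapped (swapped_lists R) q}"
      then obtain q r where q: "Answered q r \<in> set (fst z)"
        "respond ?G R q \<noteq> respond swapped (swapped_lists R) q" by auto
      have "key (Answered q r) = Some k"
        using respond_swapped[OF q(2)] by (auto simp: key_def k_eq)
      then have "Some k \<in> key ` set (fst z)" using q(1) by (metis image_eqI)
      then show "z \<in> {(h, est). Some k \<in> key ` set h}" by (cases z) simp
    qed simp
    finally show ?thesis .
  qed
  have "ennreal (1 / 2 * card ({..<n} \<times> {..<D})) \<le>
      (\<integral>\<^sup>+ (h, est). ennreal (real (length h)) \<partial>measure_spmf ?p)"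
    using prob by (intro expected_length_ge_keys) auto
  then show ?thesis
    using lossless by (simp add: expected_running_time_def card_cartesian_product)
qed

theorem theorem5p5:
  fixes \<alpha> :: real
  assumes "0 < \<alpha>" and "\<alpha> < 1"
  shows "\<exists>\<epsilon>\<^sub>0 > 0. \<exists>p\<^sub>0 > 0. \<forall>\<epsilon> p\<^sub>f :: real. 0 < \<epsilon> \<and> \<epsilon> \<le> \<epsilon>\<^sub>0 \<and> 0 < p\<^sub>f \<and> p\<^sub>f \<le> p\<^sub>0 \<longrightarrow>
    (\<exists>a\<^sub>1 > 0. \<exists>a\<^sub>2 > 0. \<exists>b\<^sub>1 > 0. \<exists>b\<^sub>2 > 0. \<exists>c > 0.
      \<forall>(n::nat) (m::nat) (\<delta>::real). 1 \<le> n \<and> n \<le> m \<and> m \<le> n ^ 2 \<and> 0 < \<delta> \<and> \<delta> \<le> 1 \<longrightarrow>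
        (\<exists>G t. walkable_digraph G \<and> t \<in> pverts G \<and>
          a\<^sub>1 * real n \<le> real (card (pverts G)) \<and> real (card (pverts G)) \<le> a\<^sub>2 * real n \<and>
          b\<^sub>1 * real m \<le> real (card (parcs G)) \<and> real (card (parcs G)) \<le> b\<^sub>2 * real m \<and>
          (\<forall>A R. solves_single_target \<alpha> \<epsilon> p\<^sub>f A \<and> represents R G \<longrightarrow>
             expected_running_time A G R t \<delta> \<ge> ennreal (c * min (real m) (real n / \<delta>)))))"
proof -
  have construction: "\<exists>G t. walkable_digraph G \<and> t \<in> pverts G \<and>
      4 * real n \<le> real (card (pverts G)) \<and> real (card (pverts G)) \<le> 5 * real n \<and>
      1 / 2 * real m \<le> real (card (parcs G)) \<and> real (card (parcs G)) \<le> 5 * real m \<and>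
      (\<forall>A R. solves_single_target \<alpha> \<epsilon> p A \<and> represents R G \<longrightarrow>
         expected_running_time A G R t \<delta> \<ge> ennreal (1 / 4 * min (real m) (real n / \<delta>)))"
    if \<epsilon>: "0 < \<epsilon>" "\<epsilon> \<le> \<alpha> * (1 - \<alpha>)\<^sup>2 / 2" and p: "p \<le> 1 / 4"
      and nm: "1 \<le> n" "n \<le> m" "m \<le> n ^ 2" and \<delta>: "0 < \<delta>" "\<delta> \<le> 1"
    for \<epsilon> p \<delta> :: real and n m :: nat
  proof -
    define d where "d = m div n"
    \<comment> \<open>\<open>D \<le> d\<close> keeps the number of arcs of order \<open>m\<close>,
      and the floor keeps \<open>\<delta> * D \<le> 1\<close>. Each rounding acts on a quantity at
      least 1 and so loses at most a factor 2.\<close>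
    define D where "D = min d (nat \<lfloor>1 / \<delta>\<rfloor>)"
    have d: "0 < d" "d \<le> n" "n * d \<le> m"
      using nm by (auto simp: d_def div_greater_zero_iff power2_eq_square div_le_mono[of m "n * n" n, simplified])
    have "m < n * d + n"
      using nm mod_less_divisor[of n m] mult_div_mod_eq[of n m] unfolding d_def by linarith
    moreover have "n * 1 \<le> n * d" using d by (intro mult_left_mono) auto
    ultimately have md: "m \<le> 2 * (n * d)" by linarith
    have floor: "1 \<le> \<lfloor>1 / \<delta>\<rfloor>" "real (nat \<lfloor>1 / \<delta>\<rfloor>) \<le> 1 / \<delta>" "1 / \<delta> \<le> 2 * real (nat \<lfloor>1 / \<delta>\<rfloor>)"
    proof -
      show one: "1 \<le> \<lfloor>1 / \<delta>\<rfloor>" using \<delta> by (simp add: le_floor_iff)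
      show "real (nat \<lfloor>1 / \<delta>\<rfloor>) \<le> 1 / \<delta>" using one by linarith
      show "1 / \<delta> \<le> 2 * real (nat \<lfloor>1 / \<delta>\<rfloor>)" using one by linarith
    qed
    have D: "0 < D" "D \<le> d" using d floor(1) by (auto simp: D_def)
    have "real D \<le> 1 / \<delta>" using floor(2) by (auto simp: D_def min_def)
    then have \<delta>D: "\<delta> * D \<le> 1" using \<delta> by (simp add: field_simps)
    have "min (real m) (real n / \<delta>) \<le> 2 * (real n * real D)"
    proof (cases "d \<le> nat \<lfloor>1 / \<delta>\<rfloor>")
      case True
      have "real m \<le> real (2 * (n * d))" using md by (simp only: of_nat_le_iff)
      then show ?thesis using True by (simp add: D_def min_def)
    next
      case False
      have "real n * (1 / \<delta>) \<le> real n * (2 * real (nat \<lfloor>1 / \<delta>\<rfloor>))"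
        using floor(3) by (intro mult_left_mono) auto
      then show ?thesis using False by (simp add: D_def min_def)
    qed
    \<comment> \<open>The constant \<open>1 / 4\<close> combines the rounding loss with the
      detection probability \<open>1 / 2\<close>.\<close>
    then have time: "ennreal (1 / 4 * min (real m) (real n / \<delta>)) \<le> ennreal (real n * real D / 2)"
      by (intro ennreal_leI) simp
    have "n * D \<le> n * d" using D by simp
    \<comment> \<open>The first two terms of the bound are at most \<open>3 * m\<close> together,
      and \<open>n\<close> and \<open>1\<close> at most \<open>m\<close> each.\<close>
    then have "card (parcs (hard_graph n D d)) \<le> 5 * m"
      using card_parcs_hard_graph(2)[of n D d] d nm by linarith
    then have arcs_le: "real (card (parcs (hard_graph n D d))) \<le> 5 * real m"
      by (metis of_nat_le_iff of_nat_mult of_nat_numeral)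
    have "m \<le> 2 * card (parcs (hard_graph n D d))"
      using card_parcs_hard_graph(1)[of n d D] md by linarith
    then have arcs_ge: "1 / 2 * real m \<le> real (card (parcs (hard_graph n D d)))" by simp
    show ?thesis
      using d D nm arcs_le arcs_ge walkable_hard_graph[of D d n]
        order_trans[OF time expected_running_time_hard_graph[OF assms \<epsilon> p _ _ _ _ \<delta>(1) \<delta>D]]
      by (intro exI[of _ "hard_graph n D d"] exI[of _ "4 * n"]) auto
  qed
  have "0 < \<alpha> * (1 - \<alpha>)\<^sup>2 / 2" using assms by simp
  then show ?thesis
    using construction
    by - (rule exI[of _ "\<alpha> * (1 - \<alpha>)\<^sup>2 / 2"], rule conjI, assumption,
        rule exI[of _ "1 / 4"], rule conjI, simp, intro allI impI,
        rule exI[of _ 4], rule conjI, simp, rule exI[of _ 5], rule conjI, simp,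
        rule exI[of _ "1 / 2"], rule conjI, simp, rule exI[of _ 5], rule conjI, simp,
        rule exI[of _ "1 / 4"], rule conjI, simp, blast)
qed

end
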